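(* There exist one-parameter semigroups $\{\phi_t\}_{t\ge0}$ of analytic self-maps of the unit disk $\mathbb{D}$ such that $A\ne[\phi_t,H^\infty]$, where $A$ is the disk algebra.
   Context: $\mathbb{D}=\{z\in\mathbb{C}:|z|<1\}$, $H(\mathbb{D})$ is the set of analytic functions on $\mathbb{D}$, and $H^\infty$ is the space of bounded functions in $H(\mathbb{D})$ with norm $\|f\|_\infty=\sup_{z\in\mathbb{D}}|f(z)|$. The disk algebra $A$ is the subspace of $H^\infty$ consisting of functions that extend to be continuous on $\overline{\mathbb{D}}$. A one-parameter semigroup $\{\phi_t\}_{t\ge0}$ of analytic functions on $\mathbb{D}$ is a family of analytic functions $\phi_t:\mathbb{D}\to\mathbb{D}$ such that: $\phi_0(z)=z$ for $z\in\mathbb{D}$; $\phi_{s+t}=\phi_s\circ\phi_t$ for all $s,t\ge0$; and $(t,z)\mapsto\phi_t(z)$ is continuous on $[0,\infty)\times\mathbb{D}$. Put $C_t(f)=f\circ\phi_t$. $[\phi_t,H^\infty]$ denotes the maximal closed subspace of $H^\infty$ on which $\{C_t\}$ is strongly continuous, i.e. on which $\lim_{t\to0^+}\|f\circ\phi_t-f\|_\infty=0$ for every element $f$. *)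

theory Defs
  imports "HOL-Complex_Analysis.Complex_Analysis"
begin

text \<open>
  Functions on the open unit disk \<open>ball 0 1\<close> are represented by total functions on
  \<open>complex\<close> whose values off the disk are irrelevant.  Membership in the function spaces
  below depends only on the restriction to the disk, so (in)equality of these sets is
  (in)equality of the corresponding spaces of functions on the disk.
\<close>

definition Hinf :: "(complex \<Rightarrow> complex) set" where
  "Hinf = {f. f holomorphic_on ball 0 1 \<and> bounded (f ` ball 0 1)}"

definition Hinf_norm :: "(complex \<Rightarrow> complex) \<Rightarrow> real" where
  "Hinf_norm f = (SUP z\<in>ball 0 1. cmod (f z))"

definition disk_algebra :: "(complex \<Rightarrow> complex) set" where
  "disk_algebra = {f \<in> Hinf. \<exists>g. continuous_on (cball 0 1) g \<and> (\<forall>z\<in>ball 0 1. g z = f z)}"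

definition disk_semigroup :: "(real \<Rightarrow> complex \<Rightarrow> complex) \<Rightarrow> bool" where
  "disk_semigroup \<phi> \<longleftrightarrow>
     (\<forall>t\<ge>0. \<phi> t holomorphic_on ball 0 1 \<and> \<phi> t ` ball 0 1 \<subseteq> ball 0 1) \<and>
     (\<forall>z\<in>ball 0 1. \<phi> 0 z = z) \<and>
     (\<forall>s\<ge>0. \<forall>t\<ge>0. \<forall>z\<in>ball 0 1. \<phi> (s + t) z = \<phi> s (\<phi> t z)) \<and>
     continuous_on ({0..} \<times> ball 0 1) (\<lambda>(t, z). \<phi> t z)"

definition closed_subspace_Hinf :: "(complex \<Rightarrow> complex) set \<Rightarrow> bool" where
  "closed_subspace_Hinf Y \<longleftrightarrow>
     Y \<subseteq> Hinf \<and>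
     (\<lambda>z. 0) \<in> Y \<and>
     (\<forall>f\<in>Y. \<forall>g\<in>Y. (\<lambda>z. f z + g z) \<in> Y) \<and>
     (\<forall>c. \<forall>f\<in>Y. (\<lambda>z. c * f z) \<in> Y) \<and>
     (\<forall>F f. (\<forall>n::nat. F n \<in> Y) \<and> f \<in> Hinf \<and>
        (\<lambda>n. Hinf_norm (\<lambda>z. F n z - f z)) \<longlonglongrightarrow> 0 \<longrightarrow> f \<in> Y)"

definition strongly_continuous_on ::
    "(real \<Rightarrow> complex \<Rightarrow> complex) \<Rightarrow> (complex \<Rightarrow> complex) set \<Rightarrow> bool" where
  "strongly_continuous_on \<phi> Y \<longleftrightarrow>
     (\<forall>f\<in>Y. ((\<lambda>t. Hinf_norm (\<lambda>z. (f \<circ> \<phi> t) z - f z)) \<longlongrightarrow> 0) (at_right 0))"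

text \<open>
  The space \<open>[\<phi>\<^sub>t, H\<^sup>\<infinity>]\<close>.  \<open>GREATEST\<close> is taken with respect to inclusion;
  lemma \<open>max_subspace_greatest\<close> shows that the greatest element exists, so that the
  description determines a set for every semigroup.
\<close>
definition max_subspace :: "(real \<Rightarrow> complex \<Rightarrow> complex) \<Rightarrow> (complex \<Rightarrow> complex) set" where
  "max_subspace \<phi> =
     (GREATEST Y. closed_subspace_Hinf Y \<and> strongly_continuous_on \<phi> Y)"

lemma Hinf_bound:
  assumes "f \<in> Hinf"
  obtains B where "\<And>z. z \<in> ball 0 1 \<Longrightarrow> cmod (f z) \<le> B"
proof -
  obtain B where "\<forall>x\<in>f ` ball 0 1. cmod x \<le> B"
    using assms unfolding Hinf_def bounded_iff by blast
  then show ?thesis by (intro that[of B]) (simp only: ball_simps)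
qed

lemma Hinf_norm_le:
  assumes "\<And>z. z \<in> ball 0 1 \<Longrightarrow> cmod (f z) \<le> B"
  shows "Hinf_norm f \<le> B"
  unfolding Hinf_norm_def by (rule cSUP_least) (use assms in auto)

lemma Hinf_norm_ge:
  assumes "\<And>z. z \<in> ball 0 1 \<Longrightarrow> cmod (f z) \<le> B" "z \<in> ball 0 1"
  shows "cmod (f z) \<le> Hinf_norm f"
  unfolding Hinf_norm_def by (rule cSUP_upper) (use assms in \<open>auto intro!: bdd_aboveI2\<close>)

lemma Hinf_norm_ge_Hinf:
  "f \<in> Hinf \<Longrightarrow> z \<in> ball 0 1 \<Longrightarrow> cmod (f z) \<le> Hinf_norm f"
  by (metis Hinf_bound Hinf_norm_ge)

lemma Hinf_add: "f \<in> Hinf \<Longrightarrow> g \<in> Hinf \<Longrightarrow> (\<lambda>z. f z + g z) \<in> Hinf"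
  unfolding Hinf_def by (auto intro!: holomorphic_intros bounded_plus_comp)

lemma Hinf_cmult: "f \<in> Hinf \<Longrightarrow> (\<lambda>z. c * f z) \<in> Hinf"
  unfolding Hinf_def
  by (auto intro!: holomorphic_intros simp: bounded_iff norm_mult)
     (meson mult_left_mono norm_ge_zero)

lemma Hinf_diff: "f \<in> Hinf \<Longrightarrow> g \<in> Hinf \<Longrightarrow> (\<lambda>z. f z - g z) \<in> Hinf"
  using Hinf_add[of f "\<lambda>z. -1 * g z"] Hinf_cmult[of g "-1"] by simp

lemma Hinf_comp:
  assumes "disk_semigroup \<phi>" "t \<ge> 0" "f \<in> Hinf"
  shows "f \<circ> \<phi> t \<in> Hinf"
proof -
  have h: "\<phi> t holomorphic_on ball 0 1" "\<phi> t ` ball 0 1 \<subseteq> ball 0 1"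
    using assms unfolding disk_semigroup_def by auto
  have "bounded ((f \<circ> \<phi> t) ` ball 0 1)"
    using assms(3) h(2) unfolding Hinf_def
    by (metis (no_types, lifting) bounded_subset image_comp image_mono mem_Collect_eq)
  then show ?thesis
    using assms(3) h holomorphic_on_compose_gen[of "\<phi> t" "ball 0 1" f "ball 0 1"]
    unfolding Hinf_def by auto
qed

lemma Hinf_norm_nonneg: "f \<in> Hinf \<Longrightarrow> 0 \<le> Hinf_norm f"
  by (rule order_trans[OF norm_ge_zero Hinf_norm_ge_Hinf[of f 0]]) auto

lemma Hinf_comp_diff:
  assumes "disk_semigroup \<phi>" "t \<ge> 0" "f \<in> Hinf"
  shows "(\<lambda>z. (f \<circ> \<phi> t) z - f z) \<in> Hinf"
  by (rule Hinf_diff[OF Hinf_comp[OF assms] assms(3)])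

lemma max_subspace_greatest:
  assumes sg: "disk_semigroup \<phi>"
  defines "Y0 \<equiv> {f \<in> Hinf.
    ((\<lambda>t. Hinf_norm (\<lambda>z. (f \<circ> \<phi> t) z - f z)) \<longlongrightarrow> 0) (at_right 0)}"
  shows "closed_subspace_Hinf Y0" "strongly_continuous_on \<phi> Y0"
    "\<And>Y. closed_subspace_Hinf Y \<Longrightarrow> strongly_continuous_on \<phi> Y \<Longrightarrow> Y \<subseteq> Y0"
    "max_subspace \<phi> = Y0"
proof -
  let ?D = "\<lambda>f t. Hinf_norm (\<lambda>z. (f \<circ> \<phi> t) z - f z)"
  have nonneg: "0 \<le> ?D f t" if "f \<in> Hinf" "t > 0" for f t
    by (rule Hinf_norm_nonneg, rule Hinf_comp_diff[OF sg]) (use that in auto)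
  have pt: "cmod (f (\<phi> t z) - f z) \<le> ?D f t" if "f \<in> Hinf" "t > 0" "z \<in> ball 0 1" for f t z
    using Hinf_norm_ge_Hinf[OF Hinf_comp_diff[OF sg _ that(1), of t] that(3)] that(2) by simp
  have into: "\<phi> t z \<in> ball 0 1" if "t > 0" "z \<in> ball 0 1" for t z
    using sg that unfolding disk_semigroup_def by (auto simp: image_subset_iff)
  have pos: "eventually (\<lambda>t::real. t > 0) (at_right 0)"
    by (simp add: eventually_at_right_less)
  have squeeze: "(?D h \<longlongrightarrow> 0) (at_right 0)"
    if "h \<in> Hinf" "(g \<longlongrightarrow> 0) (at_right 0)" "\<And>t. t > 0 \<Longrightarrow> ?D h t \<le> g t" for h g
  proof (rule tendsto_sandwich[OF _ _ tendsto_const that(2)])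
    show "eventually (\<lambda>t. 0 \<le> ?D h t) (at_right 0)"
      by (rule eventually_mono[OF pos nonneg[OF that(1)]])
    show "eventually (\<lambda>t. ?D h t \<le> g t) (at_right 0)"
      by (rule eventually_mono[OF pos that(3)])
  qed
  show cl: "closed_subspace_Hinf Y0"
    unfolding closed_subspace_Hinf_def
  proof (intro conjI ballI allI impI)
    show "Y0 \<subseteq> Hinf" by (auto simp: Y0_def)
    show "(\<lambda>z. 0) \<in> Y0" proof -
      have "bounded ((\<lambda>z::complex. 0::complex) ` ball 0 1)"
        by (rule bounded_subset[of "{0}"]) auto
      then show ?thesis by (simp add: Y0_def Hinf_def Hinf_norm_def)
    qed
  next
    fix f g assume fg: "f \<in> Y0" "g \<in> Y0"
    then have H: "f \<in> Hinf" "g \<in> Hinf" by (auto simp: Y0_def)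
    have "((\<lambda>t. ?D f t + ?D g t) \<longlongrightarrow> 0) (at_right 0)"
      using fg tendsto_add[of "?D f" 0 _ "?D g" 0] by (auto simp: Y0_def)
    moreover have "?D (\<lambda>z. f z + g z) t \<le> ?D f t + ?D g t" if "t > 0" for t
    proof (rule Hinf_norm_le)
      fix z :: complex assume z: "z \<in> ball 0 1"
      have "cmod (((\<lambda>z. f z + g z) \<circ> \<phi> t) z - (f z + g z))
          = cmod ((f (\<phi> t z) - f z) + (g (\<phi> t z) - g z))" by (simp add: algebra_simps)
      also have "\<dots> \<le> ?D f t + ?D g t"
        by (rule order_trans[OF norm_triangle_ineq add_mono[OF pt pt]]) (use H that z in auto)
      finally show "cmod (((\<lambda>z. f z + g z) \<circ> \<phi> t) z - (f z + g z)) \<le> ?D f t + ?D g t" .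
    qed
    ultimately have "(?D (\<lambda>z. f z + g z) \<longlongrightarrow> 0) (at_right 0)"
      by (rule squeeze[OF Hinf_add[OF H]])
    then show "(\<lambda>z. f z + g z) \<in> Y0" using Hinf_add[OF H] by (simp add: Y0_def)
  next
    fix c f assume f: "f \<in> Y0"
    then have H: "f \<in> Hinf" by (auto simp: Y0_def)
    have "((\<lambda>t. cmod c * ?D f t) \<longlongrightarrow> 0) (at_right 0)"
      using f tendsto_mult_left[of "?D f" 0 _ "cmod c"] by (auto simp: Y0_def)
    moreover have "?D (\<lambda>z. c * f z) t \<le> cmod c * ?D f t" if "t > 0" for t
    proof (rule Hinf_norm_le)
      fix z :: complex assume z: "z \<in> ball 0 1"
      have "cmod (((\<lambda>z. c * f z) \<circ> \<phi> t) z - c * f z) = cmod c * cmod (f (\<phi> t z) - f z)"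
        by (simp flip: norm_mult add: algebra_simps)
      also have "\<dots> \<le> cmod c * ?D f t"
        by (rule mult_left_mono[OF pt]) (use H that z in auto)
      finally show "cmod (((\<lambda>z. c * f z) \<circ> \<phi> t) z - c * f z) \<le> cmod c * ?D f t" .
    qed
    ultimately have "(?D (\<lambda>z. c * f z) \<longlongrightarrow> 0) (at_right 0)"
      by (rule squeeze[OF Hinf_cmult[OF H]])
    then show "(\<lambda>z. c * f z) \<in> Y0" using Hinf_cmult[OF H] by (simp add: Y0_def)
  next
    fix F f
    assume A: "(\<forall>n::nat. F n \<in> Y0) \<and> f \<in> Hinf \<and> (\<lambda>n. Hinf_norm (\<lambda>z. F n z - f z)) \<longlonglongrightarrow> 0"
    then have H: "f \<in> Hinf" and HF: "\<And>n. F n \<in> Hinf"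
      and lF: "\<And>n. (?D (F n) \<longlongrightarrow> 0) (at_right 0)" by (auto simp: Y0_def)
    have "(?D f \<longlongrightarrow> 0) (at_right 0)"
      unfolding tendsto_iff
    proof (intro allI impI)
      fix e :: real assume e: "e > 0"
      have "eventually (\<lambda>n. dist (Hinf_norm (\<lambda>z. F n z - f z)) 0 < e / 4) sequentially"
        using A e by (intro tendstoD) auto
      then obtain n where "dist (Hinf_norm (\<lambda>z. F n z - f z)) 0 < e / 4"
        unfolding eventually_sequentially by blast
      then have n: "Hinf_norm (\<lambda>z. F n z - f z) < e / 4" by simp
      have near: "cmod (F n z - f z) \<le> e / 4" if "z \<in> ball 0 1" for z
        using Hinf_norm_ge_Hinf[OF Hinf_diff[OF HF H] that, of n] n by simp
      have "eventually (\<lambda>t. dist (?D (F n) t) 0 < e / 4) (at_right 0)"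
        by (rule tendstoD[OF lF]) (use e in auto)
      then show "eventually (\<lambda>t. dist (?D f t) 0 < e) (at_right 0)"
        using pos
      proof eventually_elim
        case (elim t)
        have "?D f t \<le> 3 * (e / 4)"
        proof (rule Hinf_norm_le)
          fix z :: complex assume z: "z \<in> ball 0 1"
          have "cmod (F n (\<phi> t z) - F n z) \<le> e / 4"
            using pt[OF HF elim(2) z, of n] elim(1) by simp
          moreover have "cmod (f (\<phi> t z) - f z) \<le> cmod (F n (\<phi> t z) - f (\<phi> t z))
              + cmod (F n (\<phi> t z) - F n z) + cmod (F n z - f z)" by norm
          ultimately show "cmod ((f \<circ> \<phi> t) z - f z) \<le> 3 * (e / 4)"
            using near[OF z] near[OF into[OF elim(2) z]] by simp
        qed
        then show ?case using nonneg[OF H elim(2)] e by simp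
      qed
    qed
    then show "f \<in> Y0" using H by (simp add: Y0_def)
  qed
  show sc: "strongly_continuous_on \<phi> Y0"
    by (simp add: strongly_continuous_on_def Y0_def)
  show gr: "Y \<subseteq> Y0" if "closed_subspace_Hinf Y" "strongly_continuous_on \<phi> Y" for Y
    using that by (auto simp: closed_subspace_Hinf_def strongly_continuous_on_def Y0_def)
  show "max_subspace \<phi> = Y0"
    unfolding max_subspace_def by (rule Greatest_equality) (use cl sc gr in auto)
qed

end

theory Submission
  imports Defs
begin

text \<open>
  Take the affine semigroup with \<open>1 - \<phi>\<^sub>t(z) = e\<^sup>-\<^sup>t (1 - z)\<close>, whose Denjoy-Wolff point is \<open>1\<close>,
  and the function \<open>f(z) = (1 - z)\<^sup>i\<close>.  It is bounded because the argument of \<open>1 - z\<close> is, and it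
  is an eigenfunction, \<open>f \<circ> \<phi>\<^sub>t = e\<^sup>-\<^sup>i\<^sup>t f\<close>, so \<open>f \<circ> \<phi>\<^sub>t \<rightarrow> f\<close> uniformly.  It has no limit at \<open>1\<close>,
  since it takes the values \<open>(-1)\<^sup>n\<close> at the points \<open>1 - e\<^sup>-\<^sup>n\<^sup>\<pi>\<close>.
\<close>

definition affine_flow :: "real \<Rightarrow> complex \<Rightarrow> complex" where
  "affine_flow t z = 1 - of_real (exp (- t)) * (1 - z)"

text \<open>The principal branch of \<open>(1 - z)^\<i>\<close>; on the disk \<open>1 - z\<close>
  stays in the right half-plane, away from the cut of \<open>Ln\<close>.\<close>

definition osc :: "complex \<Rightarrow> complex" where
  "osc z = exp (\<i> * Ln (1 - z))"

text \<open>The image is a convex combination of \<open>1\<close> and \<open>z\<close> in which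
  \<open>z\<close> has the positive weight \<open>exp (- t)\<close>, so \<open>cmod z < 1\<close>
  keeps the bound strict.\<close>

lemma affine_flow_in_ball:
  assumes "t \<ge> 0" "z \<in> ball 0 1"
  shows "affine_flow t z \<in> ball 0 1"
proof -
  have "affine_flow t z = of_real (1 - exp (- t)) + of_real (exp (- t)) * z"
    by (simp add: affine_flow_def algebra_simps)
  also have "cmod \<dots> \<le> cmod (of_real (1 - exp (- t))) + exp (- t) * cmod z"
    by (rule order_trans[OF norm_triangle_ineq]) (simp add: norm_mult)
  also have "cmod (of_real (1 - exp (- t))) = 1 - exp (- t)"
    unfolding norm_of_real using assms by simp
  also have "1 - exp (- t) + exp (- t) * cmod z < 1"
    using assms by simp
  finally show ?thesis by simp
qed

lemma disk_semigroup_affine_flow: "disk_semigroup affine_flow"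
  unfolding disk_semigroup_def
proof (intro conjI allI impI ballI)
  fix t :: real
  show "affine_flow t holomorphic_on ball 0 1"
    unfolding affine_flow_def by (intro holomorphic_intros)
  show "affine_flow t ` ball 0 1 \<subseteq> ball 0 1" if "0 \<le> t"
    using affine_flow_in_ball[OF that] by blast
  show "affine_flow 0 z = z" for z
    by (simp add: affine_flow_def)
  show "affine_flow (s + t) z = affine_flow s (affine_flow t z)" for s z
    by (simp add: affine_flow_def mult.assoc flip: of_real_mult exp_add)
  show "continuous_on ({0..} \<times> ball 0 1) (\<lambda>(t, z). affine_flow t z)"
    unfolding affine_flow_def case_prod_beta by (intro continuous_intros)
qed

lemma Re_one_minus_pos: "z \<in> ball 0 1 \<Longrightarrow> 0 < Re (1 - z)"
  using complex_Re_le_cmod[of z] by simp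

text \<open>The modulus of \<open>exp (\<i> * w)\<close> is \<open>exp (- Im w)\<close>, and the
  imaginary part of the principal logarithm exceeds \<open>- pi\<close>.\<close>

lemma osc_le: "z \<in> ball 0 1 \<Longrightarrow> cmod (osc z) \<le> exp pi"
proof -
  assume "z \<in> ball 0 1"
  then have "1 - z \<noteq> 0"
    using Re_one_minus_pos by fastforce
  then show "cmod (osc z) \<le> exp pi"
    using mpi_less_Im_Ln[of "1 - z"] by (simp add: osc_def)
qed

lemma osc_in_Hinf: "osc \<in> Hinf"
proof -
  have "osc holomorphic_on ball 0 1"
    unfolding osc_def
  proof (intro holomorphic_intros)
    show "1 - z \<notin> \<real>\<^sub>\<le>\<^sub>0" if "z \<in> ball 0 1" for z :: complex
      using Re_one_minus_pos[OF that] by (simp add: complex_nonpos_Reals_iff)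
  qed
  then show ?thesis
    using osc_le unfolding Hinf_def bounded_iff by blast
qed

text \<open>Scaling \<open>1 - z\<close> by a positive real leaves its argument alone, so
  \<open>Ln\<close> shifts by exactly \<open>- t\<close> without a branch jump.\<close>

lemma osc_affine_flow:
  assumes "z \<in> ball 0 1"
  shows "osc (affine_flow t z) = exp (- (\<i> * of_real t)) * osc z"
proof -
  have "1 - z \<noteq> 0"
    using assms by auto
  then have "Ln (of_real (exp (- t)) * (1 - z)) = of_real (- t) + Ln (1 - z)"
    by (subst Ln_times_of_real) (auto simp: Ln_of_real)
  then show ?thesis
    by (simp add: osc_def affine_flow_def right_diff_distrib flip: exp_add)
qed

lemma osc_in_max_subspace: "osc \<in> max_subspace affine_flow"
proof -
  let ?D = "\<lambda>t. Hinf_norm (\<lambda>z. (osc \<circ> affine_flow t) z - osc z)"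
  \<comment> \<open>The eigenvalue minus one, times the uniform bound on \<open>osc\<close>: this
    majorant is free of \<open>z\<close> and vanishes as \<open>t\<close> tends to 0.\<close>
  let ?b = "\<lambda>t::real. cmod (exp (- (\<i> * of_real t)) - 1) * exp pi"
  have le: "?D t \<le> ?b t" for t
  proof (rule Hinf_norm_le)
    fix z :: complex
    assume z: "z \<in> ball 0 1"
    have "(osc \<circ> affine_flow t) z - osc z = (exp (- (\<i> * of_real t)) - 1) * osc z"
      by (simp add: osc_affine_flow[OF z] algebra_simps)
    then show "cmod ((osc \<circ> affine_flow t) z - osc z) \<le> ?b t"
      using osc_le[OF z] by (simp add: norm_mult mult_left_mono)
  qed
  have nonneg: "0 \<le> ?D t" if "t > 0" for t
    using that Hinf_norm_nonneg[OF Hinf_comp_diff[OF disk_semigroup_affine_flow _ osc_in_Hinf]]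
    by simp
  have "(?D \<longlongrightarrow> 0) (at_right 0)"
  proof (rule tendsto_sandwich)
    show "\<forall>\<^sub>F t in at_right 0. 0 \<le> ?D t"
      by (rule eventually_mono[OF eventually_at_right_less nonneg])
    show "\<forall>\<^sub>F t in at_right 0. ?D t \<le> ?b t"
      by (rule always_eventually) (intro allI le)
    show "((\<lambda>t::real. 0) \<longlongrightarrow> (0 :: real)) (at_right 0)"
      by simp
    show "(?b \<longlongrightarrow> 0) (at_right 0)"
      by (auto intro!: tendsto_eq_intros)
  qed
  then show ?thesis
    by (simp add: max_subspace_greatest(4)[OF disk_semigroup_affine_flow] osc_in_Hinf)
qed

lemma osc_not_in_disk_algebra: "osc \<notin> disk_algebra"
proof
  assume "osc \<in> disk_algebra"
  then obtain g where g: "continuous_on (cball 0 1) g" "\<And>z. z \<in> ball 0 1 \<Longrightarrow> g z = osc z"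
    unfolding disk_algebra_def by blast
  define x where "x n = 1 - exp (- (real (Suc n) * pi))" for n
  have x: "complex_of_real (x n) \<in> ball 0 1" for n
  proof -
    have "\<bar>x n\<bar> < 1"
      by (simp add: x_def abs_less_iff add_pos_nonneg less_trans[of _ 1 2])
    then show ?thesis
      by simp
  qed
  have "x \<longlonglongrightarrow> 1"
    unfolding x_def by real_asymp
  then have "(\<lambda>n. complex_of_real (x n)) \<longlonglongrightarrow> 1"
    using tendsto_of_real by fastforce
  \<comment> \<open>The boundary point \<open>1\<close> lies in \<open>cball 0 1\<close>, so the
    continuous extension would force convergence of the values along \<open>x\<close>.\<close>
  then have "(\<lambda>n. g (of_real (x n))) \<longlonglongrightarrow> g 1"
    by (rule continuous_on_tendsto_compose[OF g(1)])
       (use x in \<open>auto intro!: always_eventually less_imp_le\<close>)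
  moreover have "g (of_real (x n)) = (- 1) ^ Suc n" for n
  proof -
    have "Ln (1 - of_real (x n)) = of_real (- (real (Suc n) * pi))"
      unfolding x_def by (simp add: Ln_of_real del: of_nat_Suc)
    then have "g (of_real (x n)) = exp (- (of_nat (Suc n) * (\<i> * of_real pi)))"
      by (simp add: g(2)[OF x] osc_def mult_ac del: of_nat_Suc)
    also have "\<dots> = inverse (exp (\<i> * of_real pi) ^ Suc n)"
      by (simp only: exp_minus exp_of_nat_mult)
    also have "\<dots> = (- 1) ^ Suc n"
      by (simp add: exp_pi_i' flip: power_inverse)
    finally show ?thesis .
  qed
  ultimately have lim: "(\<lambda>n. (- 1) ^ Suc n) \<longlonglongrightarrow> g 1"
    by simp
  \<comment> \<open>Shifting the index by one negates the alternating sequence, so its limit equals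
    its own negative and must be 0, although all terms have modulus 1.\<close>
  have "(\<lambda>n. - ((- 1) ^ Suc n)) \<longlonglongrightarrow> g 1"
    using LIMSEQ_Suc[OF lim] by simp
  then have "g 1 = - g 1"
    using tendsto_minus[OF lim] LIMSEQ_unique by blast
  then have "(\<lambda>n. (- 1 :: complex) ^ Suc n) \<longlonglongrightarrow> 0"
    using lim by simp
  then have "(\<lambda>n. cmod ((- 1) ^ Suc n)) \<longlonglongrightarrow> 0"
    by (rule tendsto_norm_zero)
  then show False
    by (simp add: norm_power LIMSEQ_const_iff)
qed

theorem proposition4p3:
  "\<exists>\<phi> :: real \<Rightarrow> complex \<Rightarrow> complex. disk_semigroup \<phi> \<and> disk_algebra \<noteq> max_subspace \<phi>"
  using disk_semigroup_affine_flow osc_in_max_subspace osc_not_in_disk_algebra by blast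

end
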